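(* Let $p\ge2$ be an integer. The irreducible Fock module $W_p$ of $U_q[sl(n+1|m)]$ is unitary if and only if $q$ is a phase, i.e. $q=e^{i\phi}$, with $-\frac{\pi}{p}<\phi<\frac{\pi}{p}$.
   Context: Here $n,m$ are nonnegative integers and $q$ is a fixed nonzero complex number. Notation: $[x]=\frac{q^x-q^{-x}}{q-q^{-1}}$ (read as $[x]=x$ at $q=1$); $[r;s]=\{r,r+1,\dots,s\}$; $\theta_i=0$ for $i\in[1;n]$, $\theta_i=1$ for $i\in[n+1;n+m]$; $\bar q=q^{-1}$. The quantum superalgebra $U_q[sl(n+1|m)]$ is generated by its Jacobson generators $H_i,a_i^+,a_i^-$ ($i\in[1;n+m]$), where $\deg(H_i)=0$ and $\deg(a_i^\pm)=\theta_i$. For a number $p$, let $\bar W_p$ be the $U_q[sl(n+1|m)]$ module with basis $|p;r_1,\dots,r_{n+m}\rangle=(a_1^+)^{r_1}\cdots(a_{n+m}^+)^{r_{n+m}}|0\rangle$, where $r_i\in\mathbb Z_{\ge0}$ for $i\in[1;n]$ and $r_i\in\{0,1\}$ for $i\in[n+1;n+m]$, on which the generators act by $$H_i|p;r_1,\dots,r_{n+m}\rangle=\Bigl(p-(-1)^{\theta_i}r_i-\sum_{j=1}^{n+m}r_j\Bigr)|p;r_1,\dots,r_{n+m}\rangle,$$ $$a_i^-|p;r_1,\dots,r_{n+m}\rangle=(-1)^{\theta_1r_1+\cdots+\theta_{i-1}r_{i-1}}q^{r_1+\cdots+r_{i-1}}[r_i]\Bigl[p-\sum_{j=1}^{n+m}r_j+1\Bigr]|p;r_1,\dots,r_i-1,\dots,r_{n+m}\rangle,$$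 $$a_i^+|p;r_1,\dots,r_{n+m}\rangle=(-1)^{\theta_1r_1+\cdots+\theta_{i-1}r_{i-1}}\bar q^{\,r_1+\cdots+r_{i-1}}(1-\theta_ir_i)|p;r_1,\dots,r_i+1,\dots,r_{n+m}\rangle.$$ When $p$ is a nonnegative integer, the vectors with $\sum_ir_i>p$ span an invariant submodule $V_p$, and the Fock module is the finite-dimensional quotient $W_p=\bar W_p/V_p$, with basis the (classes of the) vectors $|p;r_1,\dots,r_{n+m}\rangle$ with $\sum_ir_i\le p$. On $W_p$ a Hermitian form $(\cdot,\cdot)$ is defined by requiring $(|0\rangle,|0\rangle)=1$ and $(a_i^\pm v,w)=(v,a_i^\mp w)$ for all $v,w\in W_p$ and $i\in[1;n+m]$. The module $W_p$ is called unitary if the Hermiticity conditions $(a_i^+)^\dagger=a_i^-$, $(a_i^-)^\dagger=a_i^+$, $(H_i)^\dagger=H_i$ hold with respect to this form and the form is positive definite, i.e. an inner product.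
   Formalization: Assumes n+m ≥ 2 and, when n = 0, p ≤ 3(m−1), as the equivalence fails otherwise: for n+m = 1 real q > 0 is unitary; for n = 0, m = 2, p = 4 so is q = e^{0.7πi}. At q = −1, where [x] is 0/0, its limit is used. *)

theory Defs
  imports Complex_Main "HOL-Library.Poly_Mapping"
begin

text \<open>
  At \<open>q = 1\<close> and \<open>q = -1\<close> the quotient \<open>(q^x - q^(-x)) / (q - q^(-1))\<close> is replaced by its
  limit, that is by the value of \<open>q^(x-1) + q^(x-3) + \<dots> + q^(1-x)\<close>.
\<close>

definition qnum :: "complex \<Rightarrow> int \<Rightarrow> complex" where
  "qnum q x =
     (if q = 1 then of_int x
      else if q = -1 then (-1) powi (x - 1) * of_int x
      else (q powi x - q powi (- x)) / (q - inverse q))"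

definition par :: "nat \<Rightarrow> nat \<Rightarrow> nat" where
  "par n i = (if i \<le> n then 0 else 1)"

text \<open>
  A basis vector \<open>|p; r\<^sub>1, \<dots>, r\<^sub>n\<^sub>+\<^sub>m\<rangle>\<close> is labelled by \<open>r :: nat \<Rightarrow> nat\<close>, normalised to be \<open>0\<close> outside
  \<open>{1..n+m}\<close>.  Vectors are finitely supported complex functions on labels.
\<close>

type_synonym state = "(nat \<Rightarrow> nat) \<Rightarrow>\<^sub>0 complex"

definition occ :: "nat \<Rightarrow> nat \<Rightarrow> (nat \<Rightarrow> nat) set" where
  "occ n m = {r. (\<forall>i. i \<notin> {1..n+m} \<longrightarrow> r i = 0) \<and> (\<forall>i\<in>{n+1..n+m}. r i \<le> 1)}"

definition rsum :: "nat \<Rightarrow> nat \<Rightarrow> (nat \<Rightarrow> nat) \<Rightarrow> nat" where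
  "rsum n m r = (\<Sum>j=1..n+m. r j)"

definition scal :: "complex \<Rightarrow> state \<Rightarrow> state" where
  "scal c v = Poly_Mapping.map ((*) c) v"

definition ket :: "(nat \<Rightarrow> nat) \<Rightarrow> state" where
  "ket r = Poly_Mapping.single r 1"

definition lin_ext :: "((nat \<Rightarrow> nat) \<Rightarrow> state) \<Rightarrow> state \<Rightarrow> state" where
  "lin_ext F v = (\<Sum>r\<in>Poly_Mapping.keys v. scal (Poly_Mapping.lookup v r) (F r))"

definition Hop :: "nat \<Rightarrow> nat \<Rightarrow> nat \<Rightarrow> nat \<Rightarrow> state \<Rightarrow> state" where
  "Hop n m p i = lin_ext (\<lambda>r.
     scal (of_int (int p - (-1) ^ par n i * int (r i) - int (rsum n m r))) (ket r))"

text \<open>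
  The truncated subtraction in \<open>r i - 1\<close> and the label \<open>r(i := r i + 1)\<close> with \<open>r i = 1\<close>, \<open>i > n\<close>
  (which is not in \<open>occ n m\<close>) are harmless, since the coefficient in front is then \<open>0\<close>.
\<close>

definition amin :: "nat \<Rightarrow> nat \<Rightarrow> nat \<Rightarrow> complex \<Rightarrow> nat \<Rightarrow> state \<Rightarrow> state" where
  "amin n m p q i = lin_ext (\<lambda>r.
     scal ((-1) ^ (\<Sum>j=1..<i. par n j * r j) * q ^ (\<Sum>j=1..<i. r j)
             * qnum q (int (r i)) * qnum q (int p - int (rsum n m r) + 1))
          (ket (r(i := r i - 1))))"

definition aplus :: "nat \<Rightarrow> complex \<Rightarrow> nat \<Rightarrow> state \<Rightarrow> state" where
  "aplus n q i = lin_ext (\<lambda>r.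
     scal ((-1) ^ (\<Sum>j=1..<i. par n j * r j) * inverse q ^ (\<Sum>j=1..<i. r j)
             * (1 - of_nat (par n i * r i)))
          (ket (r(i := r i + 1))))"

definition Wbar :: "nat \<Rightarrow> nat \<Rightarrow> state set" where
  "Wbar n m = {v. Poly_Mapping.keys v \<subseteq> occ n m}"

text \<open>The span of the basis vectors with \<open>\<Sum>i. r\<^sub>i > p\<close>.\<close>

definition Vsub :: "nat \<Rightarrow> nat \<Rightarrow> nat \<Rightarrow> state set" where
  "Vsub n m p = {v. Poly_Mapping.keys v \<subseteq> {r \<in> occ n m. p < rsum n m r}}"

definition fock_rel :: "nat \<Rightarrow> nat \<Rightarrow> nat \<Rightarrow> (state \<times> state) set" where
  "fock_rel n m p = {(v, w). v \<in> Wbar n m \<and> w \<in> Wbar n m \<and> v - w \<in> Vsub n m p}"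

definition cls :: "nat \<Rightarrow> nat \<Rightarrow> nat \<Rightarrow> state \<Rightarrow> state set" where
  "cls n m p v = fock_rel n m p `` {v}"

definition Fock :: "nat \<Rightarrow> nat \<Rightarrow> nat \<Rightarrow> state set set" where
  "Fock n m p = Wbar n m // fock_rel n m p"

text \<open>
  Operations on the quotient are induced from representatives; the unions are over equal sets,
  see \<open>cls_add\<close>, \<open>cls_scal\<close>, \<open>lift_Hop\<close>, \<open>lift_amin\<close> and \<open>lift_aplus\<close> below.
\<close>

definition fadd :: "nat \<Rightarrow> nat \<Rightarrow> nat \<Rightarrow> state set \<Rightarrow> state set \<Rightarrow> state set" where
  "fadd n m p X Y = (\<Union>v\<in>X. \<Union>w\<in>Y. cls n m p (v + w))"

definition qlift :: "nat \<Rightarrow> nat \<Rightarrow> nat \<Rightarrow> (state \<Rightarrow> state) \<Rightarrow> state set \<Rightarrow> state set" where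
  "qlift n m p T X = (\<Union>v\<in>X. cls n m p (T v))"

text \<open>Sesquilinear forms are linear in the second argument.\<close>

definition hermitian_form ::
  "nat \<Rightarrow> nat \<Rightarrow> nat \<Rightarrow> (state set \<Rightarrow> state set \<Rightarrow> complex) \<Rightarrow> bool" where
  "hermitian_form n m p B \<longleftrightarrow>
     (\<forall>X\<in>Fock n m p. \<forall>Y\<in>Fock n m p. \<forall>Z\<in>Fock n m p.
        B X (fadd n m p Y Z) = B X Y + B X Z) \<and>
     (\<forall>X\<in>Fock n m p. \<forall>Y\<in>Fock n m p. \<forall>c.
        B X (qlift n m p (scal c) Y) = c * B X Y) \<and>
     (\<forall>X\<in>Fock n m p. \<forall>Y\<in>Fock n m p. B Y X = cnj (B X Y))"

definition adjoint_wrt ::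
  "nat \<Rightarrow> nat \<Rightarrow> nat \<Rightarrow> (state set \<Rightarrow> state set \<Rightarrow> complex) \<Rightarrow>
   (state \<Rightarrow> state) \<Rightarrow> (state \<Rightarrow> state) \<Rightarrow> bool" where
  "adjoint_wrt n m p B S T \<longleftrightarrow>
     (\<forall>X\<in>Fock n m p. \<forall>Y\<in>Fock n m p. B (qlift n m p S X) Y = B X (qlift n m p T Y))"

definition fock_form ::
  "nat \<Rightarrow> nat \<Rightarrow> nat \<Rightarrow> complex \<Rightarrow> (state set \<Rightarrow> state set \<Rightarrow> complex) \<Rightarrow> bool" where
  "fock_form n m p q B \<longleftrightarrow>
     hermitian_form n m p B \<and>
     B (cls n m p (ket (\<lambda>_. 0))) (cls n m p (ket (\<lambda>_. 0))) = 1 \<and>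
     (\<forall>i\<in>{1..n+m}.
        adjoint_wrt n m p B (aplus n q i) (amin n m p q i) \<and>
        adjoint_wrt n m p B (amin n m p q i) (aplus n q i))"

text \<open>\<open>B X X\<close> is real by Hermitian symmetry.\<close>

definition positive_definite ::
  "nat \<Rightarrow> nat \<Rightarrow> nat \<Rightarrow> (state set \<Rightarrow> state set \<Rightarrow> complex) \<Rightarrow> bool" where
  "positive_definite n m p B \<longleftrightarrow>
     (\<forall>X\<in>Fock n m p. X \<noteq> cls n m p 0 \<longrightarrow> 0 < Re (B X X))"

text \<open>
  The conditions in \<open>fock_form\<close> determine \<open>B\<close> on \<open>Fock n m p\<close>, but for some \<open>q\<close> no such form exists;
  the module is then not unitary.
\<close>

definition fock_unitary :: "nat \<Rightarrow> nat \<Rightarrow> nat \<Rightarrow> complex \<Rightarrow> bool" where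
  "fock_unitary n m p q \<longleftrightarrow>
     (\<exists>B. fock_form n m p q B \<and>
          (\<forall>i\<in>{1..n+m}. adjoint_wrt n m p B (Hop n m p i) (Hop n m p i)) \<and>
          positive_definite n m p B)"

lemma lookup_scal: "Poly_Mapping.lookup (scal c v) r = c * Poly_Mapping.lookup v r"
  by (simp add: scal_def Poly_Mapping.map.rep_eq when_def)

lemma lookup_lin_ext_superset:
  assumes "finite A" "Poly_Mapping.keys v \<subseteq> A"
  shows "lin_ext F v = (\<Sum>r\<in>A. scal (Poly_Mapping.lookup v r) (F r))"
  unfolding lin_ext_def
proof (rule sum.mono_neutral_left)
  show "\<forall>i\<in>A - Poly_Mapping.keys v. scal (Poly_Mapping.lookup v i) (F i) = 0"
    by (auto intro!: poly_mapping_eqI simp: lookup_scal in_keys_iff)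
qed (use assms in auto)

lemma scal_diff: "scal (a - b) v = scal a v - scal b v"
  by (rule poly_mapping_eqI) (simp add: lookup_scal lookup_minus algebra_simps)

lemma lin_ext_diff: "lin_ext F (v - w) = lin_ext F v - lin_ext F w"
proof -
  let ?A = "Poly_Mapping.keys v \<union> Poly_Mapping.keys w"
  have "Poly_Mapping.keys (v - w) \<subseteq> ?A"
    by (auto simp: in_keys_iff lookup_minus)
  then show ?thesis
    using lookup_lin_ext_superset[of ?A "v - w" F] lookup_lin_ext_superset[of ?A v F]
      lookup_lin_ext_superset[of ?A w F]
    by (simp add: lookup_minus scal_diff sum_subtractf)
qed

lemma Hop_diff: "Hop n m p i (v - w) = Hop n m p i v - Hop n m p i w"
  unfolding Hop_def by (rule lin_ext_diff)

lemma amin_diff: "amin n m p q i (v - w) = amin n m p q i v - amin n m p q i w"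
  unfolding amin_def by (rule lin_ext_diff)

lemma aplus_diff: "aplus n q i (v - w) = aplus n q i v - aplus n q i w"
  unfolding aplus_def by (rule lin_ext_diff)

lemma lin_ext_keys:
  assumes "\<And>r. r \<in> Poly_Mapping.keys v \<Longrightarrow> Poly_Mapping.keys (F r) \<subseteq> S"
  shows "Poly_Mapping.keys (lin_ext F v) \<subseteq> S"
proof
  fix s assume "s \<in> Poly_Mapping.keys (lin_ext F v)"
  then have "(\<Sum>r\<in>Poly_Mapping.keys v. Poly_Mapping.lookup v r * Poly_Mapping.lookup (F r) s) \<noteq> 0"
    by (simp add: lin_ext_def in_keys_iff lookup_sum lookup_scal)
  then obtain r where "r \<in> Poly_Mapping.keys v" "Poly_Mapping.lookup (F r) s \<noteq> 0"
    by (metis (no_types, lifting) mult_zero_right sum.neutral)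
  then show "s \<in> S" using assms[of r] by (auto simp: in_keys_iff)
qed

lemma keys_scal_ket: "Poly_Mapping.keys (scal c (ket r)) = (if c = 0 then {} else {r})"
  by (auto simp: in_keys_iff lookup_scal ket_def lookup_single when_def
      simp del: keys_eq_empty split: if_splits)

lemma qnum_0: "qnum q 0 = 0"
  by (simp add: qnum_def)

lemma rsum_upd:
  assumes "i \<in> {1..n+m}"
  shows "rsum n m (r(i := k)) + r i = rsum n m r + k"
  using assms by (simp add: rsum_def sum.remove[of _ i])

lemma occ_Suc:
  assumes "r \<in> occ n m" "i \<in> {1..n+m}" "par n i * r i \<noteq> 1"
  shows "r(i := r i + 1) \<in> occ n m"
proof -
  have "r i = 0" if "i \<in> {n+1..n+m}"
  proof -
    have "r i \<le> 1" using assms(1) that by (simp add: occ_def)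
    then show ?thesis using assms(3) that by (simp add: par_def)
  qed
  then show ?thesis using assms(1,2) by (simp add: occ_def)
qed

lemma occ_pred: "r \<in> occ n m \<Longrightarrow> r(i := r i - 1) \<in> occ n m"
  by (force simp: occ_def)

lemma Hop_inv:
  "v \<in> Wbar n m \<Longrightarrow> Hop n m p i v \<in> Wbar n m"
  "v \<in> Vsub n m p \<Longrightarrow> Hop n m p i v \<in> Vsub n m p"
  unfolding Wbar_def Vsub_def Hop_def mem_Collect_eq
  by (rule lin_ext_keys; auto simp: keys_scal_ket)+

lemma aplus_inv:
  assumes "i \<in> {1..n+m}"
  shows "v \<in> Wbar n m \<Longrightarrow> aplus n q i v \<in> Wbar n m"
    and "v \<in> Vsub n m p \<Longrightarrow> aplus n q i v \<in> Vsub n m p"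
proof -
  have tot: "rsum n m (r(i := Suc (r i))) = Suc (rsum n m r)" for r
    using rsum_upd[OF assms, of r "Suc (r i)"] by simp
  have occ: "r(i := Suc (r i)) \<in> occ n m" if "r \<in> occ n m" "of_nat (par n i * r i) \<noteq> (1::complex)" for r
    using occ_Suc[OF that(1) assms] that(2) by (metis Suc_eq_plus1 of_nat_1)
  show "v \<in> Wbar n m \<Longrightarrow> aplus n q i v \<in> Wbar n m"
    unfolding Wbar_def aplus_def mem_Collect_eq
    by (rule lin_ext_keys) (use occ in \<open>auto simp: keys_scal_ket\<close>)
  show "v \<in> Vsub n m p \<Longrightarrow> aplus n q i v \<in> Vsub n m p"
    unfolding Vsub_def aplus_def mem_Collect_eq
    by (rule lin_ext_keys) (use occ in \<open>auto simp: keys_scal_ket tot\<close>)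
qed

lemma amin_inv:
  assumes "i \<in> {1..n+m}"
  shows "v \<in> Wbar n m \<Longrightarrow> amin n m p q i v \<in> Wbar n m"
    and "v \<in> Vsub n m p \<Longrightarrow> amin n m p q i v \<in> Vsub n m p"
proof -
  have tot: "p < rsum n m (r(i := r i - 1))"
    if "p < rsum n m r" "qnum q (int (r i)) \<noteq> 0" "qnum q (int p - int (rsum n m r) + 1) \<noteq> 0" for r
  proof -
    have "r i \<noteq> 0" using that(2) qnum_0 by (metis of_nat_0)
    moreover have "int p - int (rsum n m r) + 1 \<noteq> 0" using that(3) qnum_0 by metis
    ultimately show ?thesis
      using rsum_upd[OF assms, of r "r i - 1"] that(1) by linarith
  qed
  show "v \<in> Wbar n m \<Longrightarrow> amin n m p q i v \<in> Wbar n m"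
    unfolding Wbar_def amin_def mem_Collect_eq
    by (rule lin_ext_keys) (use occ_pred in \<open>auto simp: keys_scal_ket\<close>)
  show "v \<in> Vsub n m p \<Longrightarrow> amin n m p q i v \<in> Vsub n m p"
    unfolding Vsub_def amin_def mem_Collect_eq
    by (rule lin_ext_keys) (use occ_pred tot in \<open>auto simp: keys_scal_ket\<close>)
qed

lemma Vsub_add: "v \<in> Vsub n m p \<Longrightarrow> w \<in> Vsub n m p \<Longrightarrow> v + w \<in> Vsub n m p"
  unfolding Vsub_def using Poly_Mapping.keys_add[of v w] by blast

lemma Vsub_scal: "v \<in> Vsub n m p \<Longrightarrow> scal c v \<in> Vsub n m p"
  by (auto simp: Vsub_def in_keys_iff lookup_scal subset_iff)

lemma equiv_fock_rel: "equiv (Wbar n m) (fock_rel n m p)"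
proof (rule equivI)
  show "refl_on (Wbar n m) (fock_rel n m p)"
    by (auto simp: refl_on_def fock_rel_def Vsub_def)
  show "sym (fock_rel n m p)"
    by (auto simp: sym_def fock_rel_def Vsub_def subset_iff in_keys_iff lookup_minus)
  show "trans (fock_rel n m p)"
  proof (rule transI)
    fix x y z assume "(x, y) \<in> fock_rel n m p" "(y, z) \<in> fock_rel n m p"
    then show "(x, z) \<in> fock_rel n m p"
      using Vsub_add[of "x - y" n m p "y - z"] by (simp add: fock_rel_def)
  qed
qed (auto simp: fock_rel_def)

lemma cls_eq: "(v, w) \<in> fock_rel n m p \<Longrightarrow> cls n m p v = cls n m p w"
  unfolding cls_def by (rule equiv_class_eq[OF equiv_fock_rel])

lemma lift_cls:
  assumes v: "v \<in> Wbar n m"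
    and W: "\<And>v. v \<in> Wbar n m \<Longrightarrow> T v \<in> Wbar n m"
    and V: "\<And>v. v \<in> Vsub n m p \<Longrightarrow> T v \<in> Vsub n m p"
    and diff: "\<And>v w. T (v - w) = T v - T w"
  shows "qlift n m p T (cls n m p v) = cls n m p (T v)"
proof -
  have "cls n m p (T w) = cls n m p (T v)" if "w \<in> cls n m p v" for w
  proof (rule cls_eq[symmetric])
    show "(T v, T w) \<in> fock_rel n m p"
      using that W V[of "v - w"] diff by (simp add: cls_def fock_rel_def)
  qed
  moreover have "v \<in> cls n m p v"
    unfolding cls_def by (rule equiv_class_self[OF equiv_fock_rel v])
  ultimately show ?thesis
    unfolding qlift_def by blast
qed

lemma cls_add:
  assumes v: "v \<in> Wbar n m" and w: "w \<in> Wbar n m"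
  shows "fadd n m p (cls n m p v) (cls n m p w) = cls n m p (v + w)"
proof -
  have W: "x + y \<in> Wbar n m" if "x \<in> Wbar n m" "y \<in> Wbar n m" for x y
    using that Poly_Mapping.keys_add[of x y] unfolding Wbar_def by blast
  have "cls n m p (x + y) = cls n m p (v + w)"
    if "x \<in> cls n m p v" "y \<in> cls n m p w" for x y
  proof (rule cls_eq[symmetric])
    show "(v + w, x + y) \<in> fock_rel n m p"
      using that W Vsub_add[of "v - x" n m p "w - y"]
      by (simp add: cls_def fock_rel_def algebra_simps)
  qed
  moreover have "v \<in> cls n m p v" "w \<in> cls n m p w"
    unfolding cls_def by (rule equiv_class_self[OF equiv_fock_rel], fact)+
  ultimately show ?thesis
    unfolding fadd_def by blast
qed

lemma cls_scal:
  "v \<in> Wbar n m \<Longrightarrow> qlift n m p (scal c) (cls n m p v) = cls n m p (scal c v)"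
proof (rule lift_cls)
  show "scal c v \<in> Wbar n m" if "v \<in> Wbar n m" for v
    using that by (auto simp: Wbar_def in_keys_iff lookup_scal subset_iff)
  show "scal c (v - w) = scal c v - scal c w" for v w
    by (rule poly_mapping_eqI) (simp add: lookup_scal lookup_minus algebra_simps)
qed (auto intro: Vsub_scal)

lemma lift_Hop:
  "v \<in> Wbar n m \<Longrightarrow> qlift n m p (Hop n m p i) (cls n m p v) = cls n m p (Hop n m p i v)"
  by (rule lift_cls) (auto intro: Hop_inv simp: Hop_diff)

lemma lift_amin:
  "v \<in> Wbar n m \<Longrightarrow> i \<in> {1..n+m} \<Longrightarrow>
     qlift n m p (amin n m p q i) (cls n m p v) = cls n m p (amin n m p q i v)"
  by (rule lift_cls) (auto intro: amin_inv simp: amin_diff)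

lemma lift_aplus:
  "v \<in> Wbar n m \<Longrightarrow> i \<in> {1..n+m} \<Longrightarrow>
     qlift n m p (aplus n q i) (cls n m p v) = cls n m p (aplus n q i v)"
  by (rule lift_cls) (auto intro: aplus_inv simp: aplus_diff)

end

theory Submission
  imports Defs
begin

text \<open>
  Writing \<open>|r + e\<^sub>i\<rangle>\<close> as a multiple of \<open>a\<^sub>i\<^sup>+ |r\<rangle>\<close>, the adjointness of \<open>a\<^sub>i\<^sup>\<plusminus>\<close> forces
  \<open>\<parallel>r + e\<^sub>i\<parallel>\<^sup>2 = |q|\<^bsup>2k\<^esup> [r\<^sub>i + 1] [p - \<Sum>r] \<parallel>r\<parallel>\<^sup>2\<close> with \<open>k = r\<^sub>1 + \<dots> + r\<^sub>i\<^sub>-\<^sub>1\<close>.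
  Reaching \<open>e\<^sub>1 + e\<^sub>2\<close> along the two possible paths gives \<open>|q| = 1\<close>, and adding a particle to an
  empty mode gives \<open>[x] > 0\<close> for every \<open>x = p - \<Sum>r\<close> that leaves an empty mode.  With \<open>q = cis \<phi>\<close>
  these are conditions \<open>sin (x \<phi>) / sin \<phi> > 0\<close> on consecutive \<open>x\<close>, and since the steps are shorter
  than \<open>\<pi>\<close> the \<open>x |\<phi>|\<close> cannot jump over an arc on which the sine is negative.
  For the converse, the recursion defines positive weights making the basis orthogonal.
\<close>

section \<open>The ladder operators on basis vectors\<close>

definition raise_coeff :: "nat \<Rightarrow> complex \<Rightarrow> nat \<Rightarrow> (nat \<Rightarrow> nat) \<Rightarrow> complex" where
  "raise_coeff n q i r =
     (-1) ^ (\<Sum>j=1..<i. par n j * r j) * inverse q ^ (\<Sum>j=1..<i. r j)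
       * (1 - of_nat (par n i * r i))"

definition lower_coeff ::
  "nat \<Rightarrow> nat \<Rightarrow> nat \<Rightarrow> complex \<Rightarrow> nat \<Rightarrow> (nat \<Rightarrow> nat) \<Rightarrow> complex" where
  "lower_coeff n m p q i r =
     (-1) ^ (\<Sum>j=1..<i. par n j * r j) * q ^ (\<Sum>j=1..<i. r j)
       * qnum q (int (r i)) * qnum q (int p - int (rsum n m r) + 1)"

lemma aplus_altdef:
  "aplus n q i = lin_ext (\<lambda>r. scal (raise_coeff n q i r) (ket (r(i := r i + 1))))"
  by (simp add: aplus_def raise_coeff_def)

lemma amin_altdef:
  "amin n m p q i = lin_ext (\<lambda>r. scal (lower_coeff n m p q i r) (ket (r(i := r i - 1))))"
  by (simp add: amin_def lower_coeff_def)

lemma lookup_lin_ext: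
  "Poly_Mapping.lookup (lin_ext F v) s =
     (\<Sum>r\<in>Poly_Mapping.keys v. Poly_Mapping.lookup v r * Poly_Mapping.lookup (F r) s)"
  by (simp add: lin_ext_def lookup_sum lookup_scal)

text \<open>Each ladder operator sends basis labels to multiples of basis labels, so at most one
  label \<open>t\<close> contributes to the coefficient at \<open>s\<close>. This turns the
  operators into closed coefficient formulas.\<close>

lemma lookup_lin_ext_unique:
  assumes "\<And>r. r \<noteq> t \<Longrightarrow> Poly_Mapping.lookup (F r) s = 0"
  shows "Poly_Mapping.lookup (lin_ext F v) s =
    Poly_Mapping.lookup v t * Poly_Mapping.lookup (F t) s"
proof -
  have "Poly_Mapping.lookup (lin_ext F v) s =
    (\<Sum>r\<in>Poly_Mapping.keys v. if r = t
       then Poly_Mapping.lookup v t * Poly_Mapping.lookup (F t) s else 0)"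
    unfolding lookup_lin_ext by (rule sum.cong) (use assms in auto)
  then show ?thesis by (simp add: in_keys_iff)
qed

lemma lookup_scal_ket: "Poly_Mapping.lookup (scal c (ket r)) s = (if r = s then c else 0)"
  by (simp add: lookup_scal ket_def lookup_single when_def)

lemma lin_ext_ket: "lin_ext F (ket r) = F r"
  by (rule poly_mapping_eqI)
     (simp add: lookup_lin_ext ket_def)

lemma lookup_aplus:
  "Poly_Mapping.lookup (aplus n q i v) s =
     (if s i = 0 then 0
      else Poly_Mapping.lookup v (s(i := s i - 1)) * raise_coeff n q i (s(i := s i - 1)))"
proof (cases "s i = 0")
  case True
  then have "r(i := r i + 1) \<noteq> s" for r by auto
  then show ?thesis
    using True by (simp add: aplus_altdef lookup_lin_ext lookup_scal_ket)
next
  case False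
  have "r(i := r i + 1) = s \<longleftrightarrow> r = s(i := s i - 1)" for r
    using False by (auto simp: fun_eq_iff)
  then show ?thesis
    using False unfolding aplus_altdef
    by (subst lookup_lin_ext_unique[where t = "s(i := s i - 1)"]) (auto simp: lookup_scal_ket)
qed

lemma lookup_amin:
  "Poly_Mapping.lookup (amin n m p q i v) s =
     Poly_Mapping.lookup v (s(i := s i + 1)) * lower_coeff n m p q i (s(i := s i + 1))"
proof -
  \<comment> \<open>Truncated subtraction makes the lowering of labels non-injective: a label with
    \<open>r i = 0\<close> is fixed. Its coefficient contains \<open>qnum q 0\<close>, so it
    contributes nothing.\<close>
  have "r(i := r i - 1) \<noteq> s \<or> lower_coeff n m p q i r = 0" if "r \<noteq> s(i := s i + 1)" for r
  proof (cases "r i = 0")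
    case True
    then show ?thesis by (simp add: lower_coeff_def qnum_0)
  next
    case False
    then have "(r(i := r i - 1))(i := (r(i := r i - 1)) i + 1) = r" by simp
    then show ?thesis using that by metis
  qed
  then show ?thesis
    unfolding amin_altdef
    by (subst lookup_lin_ext_unique[where t = "s(i := s i + 1)"]) (auto simp: lookup_scal_ket)
qed

lemma lookup_Hop:
  "Poly_Mapping.lookup (Hop n m p i v) s = Poly_Mapping.lookup v s
     * of_int (int p - (-1) ^ par n i * int (s i) - int (rsum n m s))"
  unfolding Hop_def
  by (subst lookup_lin_ext_unique[where t = s]) (auto simp: lookup_scal_ket)

lemma rsum_Suc: "i \<in> {1..n+m} \<Longrightarrow> rsum n m (r(i := Suc (r i))) = Suc (rsum n m r)"
  using rsum_upd[of i n m r "Suc (r i)"] by simp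

lemma sum_below_upd: "(\<Sum>j=1..<i. f j ((r(i := k)) j)) = (\<Sum>j=1..<i. f j (r j))"
  for f :: "nat \<Rightarrow> nat \<Rightarrow> nat"
  by (rule sum.cong) auto

lemma lower_coeff_Suc:
  assumes "i \<in> {1..n+m}"
  shows "lower_coeff n m p q i (r(i := Suc (r i))) =
     (-1) ^ (\<Sum>j=1..<i. par n j * r j) * q ^ (\<Sum>j=1..<i. r j)
       * qnum q (int (Suc (r i))) * qnum q (int p - int (rsum n m r))"
  unfolding lower_coeff_def
  using sum_below_upd[of "\<lambda>j x. par n j * x" r i "Suc (r i)"]
    sum_below_upd[of "\<lambda>j x. x" r i "Suc (r i)"] rsum_Suc[OF assms, of r]
  by simp

section \<open>Quantum numbers at a phase\<close>

lemma qnum_1: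
  assumes "q \<noteq> 0"
  shows "qnum q 1 = 1"
proof -
  have "q - inverse q \<noteq> 0" if "q \<noteq> 1" "q \<noteq> -1"
  proof
    assume "q - inverse q = 0"
    then have "(q - 1) * (q + 1) = 0" using assms by (simp add: field_simps)
    then show False using that by (auto simp: eq_neg_iff_add_eq_0)
  qed
  then show ?thesis by (auto simp: qnum_def)
qed

text \<open>Numerator and denominator are \<open>2 * \<i>\<close> times a sine. A nonzero
  \<open>sin \<phi>\<close> also rules out \<open>q = 1\<close> and \<open>q = -1\<close>, where
  \<open>qnum\<close> is defined separately.\<close>

lemma qnum_cis:
  assumes "sin \<phi> \<noteq> 0"
  shows "qnum (cis \<phi>) x = complex_of_real (sin (of_int x * \<phi>) / sin \<phi>)"
proof -
  have ne: "cis \<phi> \<noteq> 1" "cis \<phi> \<noteq> -1"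
    using assms by (auto simp: complex_eq_iff)
  have "cis \<phi> powi x = cis (of_int x * \<phi>)" for x
    by (simp add: cis_power_int)
  then have "cis \<phi> powi x - cis \<phi> powi (- x) = 2 * \<i> * complex_of_real (sin (of_int x * \<phi>))"
    by (simp add: complex_eq_iff)
  moreover have "cis \<phi> - inverse (cis \<phi>) = 2 * \<i> * complex_of_real (sin \<phi>)"
    by (simp add: complex_eq_iff)
  ultimately show ?thesis
    using ne assms by (simp add: qnum_def)
qed

text \<open>As long as \<open>x * \<bar>\<phi>\<bar> < pi\<close>, both sines in
  \<open>qnum_cis\<close> have the sign of \<open>\<phi>\<close>. Reality is stated for every
  \<open>y\<close> because \<open>wform_adjoint\<close> needs a real \<open>g\<close> at all
  arguments, including 0.\<close>

lemma qnum_phase_pos: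
  assumes "2 \<le> p" "\<bar>\<phi>\<bar> < pi / real p" "1 \<le> x" "x \<le> p"
  shows "0 < Re (qnum (cis \<phi>) (int x))"
    and "qnum (cis \<phi>) (int y) = complex_of_real (Re (qnum (cis \<phi>) (int y)))"
proof -
  have p\<phi>: "real p * \<bar>\<phi>\<bar> < pi" using assms(1,2) by (simp add: field_simps)
  have sgn: "0 < sin (real z * \<phi>) / sin \<phi>" if "\<phi> \<noteq> 0" "1 \<le> z" "z \<le> p" for z
  proof -
    have pos: "0 < sin (real z * \<bar>\<phi>\<bar>)" if z: "1 \<le> z" "z \<le> p" for z
    proof (rule sin_gt_zero)
      show "0 < real z * \<bar>\<phi>\<bar>" using z \<open>\<phi> \<noteq> 0\<close> by simp
      have "real z * \<bar>\<phi>\<bar> \<le> real p * \<bar>\<phi>\<bar>" using z by (intro mult_right_mono) auto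
      then show "real z * \<bar>\<phi>\<bar> < pi" using p\<phi> by linarith
    qed
    show ?thesis
      using pos[OF that(2,3)] pos[of 1] assms(1) by (auto simp: abs_if divide_neg_neg split: if_splits)
  qed
  show "0 < Re (qnum (cis \<phi>) (int x))"
  proof (cases "\<phi> = 0")
    case True
    then show ?thesis using assms by (simp add: qnum_def)
  next
    case False
    then have "sin \<phi> \<noteq> 0" using sgn[of 1] assms(1) by auto
    then show ?thesis using sgn[OF False assms(3,4)] by (simp add: qnum_cis)
  qed
  show "qnum (cis \<phi>) (int y) = complex_of_real (Re (qnum (cis \<phi>) (int y)))"
  proof (cases "\<phi> = 0")
    case True
    then show ?thesis by (simp add: qnum_def)
  next
    case False
    then have "sin \<phi> \<noteq> 0" using sgn[of 1] assms(1) by auto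
    then show ?thesis by (simp add: qnum_cis)
  qed
qed

text \<open>
  All multiples of \<open>\<psi>\<close> in question lie in one arc \<open>(2k\<pi>, (2k+1)\<pi>)\<close>; the last hypothesis
  excludes \<open>k > 0\<close>, as then \<open>a \<psi> > 2 \<pi>\<close> while \<open>(p - a) \<psi> < \<pi>\<close>.
\<close>

lemma sin_pos_consecutive:
  fixes \<psi> :: real and a p :: nat
  assumes "0 < \<psi>" "\<psi> < pi" "a \<le> p"
    and pos: "\<And>x. a \<le> x \<Longrightarrow> x \<le> p \<Longrightarrow> 0 < sin (real x * \<psi>)"
    and "a = 1 \<or> a \<le> 2 * (p - a)"
  shows "real p * \<psi> < pi"
proof -
  \<comment> \<open>\<open>k\<close> numbers the period of the sine that contains
    \<open>a * \<psi>\<close>, and \<open>s\<close> is the left end of that period.\<close>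
  define k where "k = \<lfloor>real a * \<psi> / (2 * pi)\<rfloor>"
  define s where "s = 2 * of_int k * pi"
  have sin_s: "sin (y - s) = sin y" for y
    using sin_int_2pin[of k] cos_int_2pin[of k] by (simp add: sin_diff s_def mult_ac)
  have "of_int k \<le> real a * \<psi> / (2 * pi)" "real a * \<psi> / (2 * pi) < of_int k + 1"
    unfolding k_def by linarith+
  then have a_lo: "s \<le> real a * \<psi>" and a_hi: "real a * \<psi> < s + 2 * pi"
    by (simp_all add: s_def field_simps)
  \<comment> \<open>The window \<open>(s - pi, s + 2 * pi)\<close> contains one positive arc of the
    sine, with a nonpositive half period on either side.\<close>
  have arc: "s < y \<and> y < s + pi" if "0 < sin y" "s - pi < y" "y < s + 2 * pi" for y
  proof (rule ccontr)
    assume "\<not> (s < y \<and> y < s + pi)"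
    then consider "y \<le> s" | "s + pi \<le> y" by linarith
    then have "sin (y - s) \<le> 0"
    proof cases
      case 1
      then have "0 \<le> sin (s - y)" using that by (intro sin_ge_zero) auto
      then show ?thesis using sin_minus[of "s - y"] by simp
    next
      case 2
      then show ?thesis using that by (intro sin_le_zero) auto
    qed
    then show False using that sin_s by simp
  qed
  \<comment> \<open>A step of length below \<open>pi\<close> from inside the arc cannot leave the
    window of \<open>arc\<close>, and positivity puts the new point back into the same arc.\<close>
  have all: "s < real x * \<psi> \<and> real x * \<psi> < s + pi" if "a \<le> x" "x \<le> p" for x
    using that
  proof (induction x rule: dec_induct)
    case base
    then show ?case using arc[OF pos[of a]] a_lo a_hi assms(3) by simp
  next
    case (step x)
    have "real (Suc x) * \<psi> = real x * \<psi> + \<psi>" by (simp add: algebra_simps)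
    then show ?case
      using step arc[OF pos[of "Suc x"]] assms(1,2) by simp
  qed
  have "s < 2 * pi"
  proof (rule ccontr)
    assume "\<not> s < 2 * pi"
    then have big: "2 * pi < real a * \<psi>" using all[of a] assms(3) by linarith
    have "real p * \<psi> - real a * \<psi> < pi" using all[of a] all[of p] assms(3) by linarith
    then have small: "real (p - a) * \<psi> < pi" using assms(3) by (simp add: of_nat_diff algebra_simps)
    from assms(5) show False
    proof
      assume "a = 1"
      then show False using big assms(2) pi_gt_zero by simp
    next
      assume "a \<le> 2 * (p - a)"
      then have "real a \<le> 2 * real (p - a)" by linarith
      then have "real a * \<psi> \<le> 2 * real (p - a) * \<psi>" using assms(1) by (intro mult_right_mono) auto
      then show False using big small by linarith
    qed
  qed
  then have "k < 1" by (simp add: s_def)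
  then have "s \<le> 0" by (simp add: s_def mult_nonpos_nonneg)
  then show ?thesis using all[of p] assms(3) by linarith
qed

section \<open>Consequences of unitarity\<close>

lemma ket_in_Wbar: "r \<in> occ n m \<Longrightarrow> ket r \<in> Wbar n m"
  by (simp add: Wbar_def ket_def)

lemma scal_in_Wbar: "v \<in> Wbar n m \<Longrightarrow> scal c v \<in> Wbar n m"
  by (auto simp: Wbar_def in_keys_iff lookup_scal subset_iff)

lemma cls_in_Fock: "v \<in> Wbar n m \<Longrightarrow> cls n m p v \<in> Fock n m p"
  unfolding Fock_def cls_def by (rule quotientI)

lemma cls_eq_iff:
  "v \<in> Wbar n m \<Longrightarrow> w \<in> Wbar n m \<Longrightarrow> cls n m p v = cls n m p w \<longleftrightarrow> v - w \<in> Vsub n m p"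
  unfolding cls_def
  using eq_equiv_class_iff[OF equiv_fock_rel, of v n m w p] by (simp add: fock_rel_def)

lemma form_scal_right:
  assumes "hermitian_form n m p B" "v \<in> Wbar n m" "w \<in> Wbar n m"
  shows "B (cls n m p v) (cls n m p (scal c w)) = c * B (cls n m p v) (cls n m p w)"
  using assms unfolding hermitian_form_def
  by (metis cls_in_Fock cls_scal)

lemma form_scal_left:
  assumes "hermitian_form n m p B" "v \<in> Wbar n m" "w \<in> Wbar n m"
  shows "B (cls n m p (scal c v)) (cls n m p w) = cnj c * B (cls n m p v) (cls n m p w)"
proof -
  have sym: "B Y X = cnj (B X Y)" if "X \<in> Fock n m p" "Y \<in> Fock n m p" for X Y
    using assms(1) that unfolding hermitian_form_def by blast
  show ?thesis
    using sym form_scal_right[OF assms(1,3,2), of c] assms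
    by (metis cls_in_Fock complex_cnj_mult scal_in_Wbar)
qed

text \<open>Adjointness is applied to \<open>ket r\<close> and the raised ket. The form is conjugate
  linear on the left, so the two powers of \<open>q\<close> combine to
  \<open>cmod q ^ (2 * k)\<close> instead of cancelling. The condition \<open>free\<close> keeps the
  factor \<open>1 - par n i * r i\<close> of the raising operator equal to 1.\<close>

lemma norm_step:
  assumes form: "fock_form n m p q B" and "q \<noteq> 0"
    and i: "i \<in> {1..n+m}" and r: "r \<in> occ n m" and free: "n < i \<Longrightarrow> r i = 0"
  defines "N \<equiv> \<lambda>r. B (cls n m p (ket r)) (cls n m p (ket r))"
  shows "N (r(i := Suc (r i))) = of_real (cmod q ^ (2 * (\<Sum>j=1..<i. r j)))
    * qnum q (int (Suc (r i))) * qnum q (int p - int (rsum n m r)) * N r"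
proof -
  define s where "s = r(i := Suc (r i))"
  define k where "k = (\<Sum>j=1..<i. r j)"
  define e :: complex where "e = (-1) ^ (\<Sum>j=1..<i. par n j * r j)"
  have herm: "hermitian_form n m p B" using form by (simp add: fock_form_def)
  have pr: "par n i * r i = 0" using free by (simp add: par_def)
  have s_occ: "s \<in> occ n m" using occ_Suc[OF r i] pr by (simp add: s_def)
  have kr: "ket r \<in> Wbar n m" and ks: "ket s \<in> Wbar n m"
    using r s_occ by (simp_all add: ket_in_Wbar)
  have up: "aplus n q i (ket r) = scal (e * inverse q ^ k) (ket s)"
    unfolding aplus_altdef lin_ext_ket raise_coeff_def pr
    by (simp add: s_def k_def e_def)
  have down: "amin n m p q i (ket s) =
      scal (e * q ^ k * qnum q (int (Suc (r i))) * qnum q (int p - int (rsum n m r))) (ket r)"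
    using lower_coeff_Suc[OF i, of p q r]
    by (simp add: amin_altdef lin_ext_ket s_def k_def e_def fun_upd_idem)
  have "B (qlift n m p (aplus n q i) (cls n m p (ket r))) (cls n m p (ket s)) =
    B (cls n m p (ket r)) (qlift n m p (amin n m p q i) (cls n m p (ket s)))"
    using form i kr ks cls_in_Fock unfolding fock_form_def adjoint_wrt_def by blast
  then have eq: "cnj (e * inverse q ^ k) * N s =
      e * q ^ k * qnum q (int (Suc (r i))) * qnum q (int p - int (rsum n m r)) * N r"
    using form_scal_left[OF herm kr kr] form_scal_left[OF herm ks ks]
      form_scal_right[OF herm kr kr]
    by (simp add: lift_aplus[OF kr i] lift_amin[OF ks i] up down N_def)
  have e2: "e * e = 1" "cnj e = e"
    by (simp_all add: e_def flip: power_mult_distrib)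
  have qq: "complex_of_real (cmod q ^ (2 * k)) = cnj q ^ k * q ^ k"
    by (metis complex_norm_square mult.commute of_real_power power_mult power_mult_distrib)
  have c1: "cnj q ^ k * cnj (inverse q ^ k) = 1"
    using \<open>q \<noteq> 0\<close> by (simp flip: power_mult_distrib)
  have "N s = (e * e) * (cnj q ^ k * cnj (inverse q ^ k)) * N s"
    using e2 c1 by simp
  \<comment> \<open>Multiplying \<open>eq\<close> by \<open>e * cnj q ^ k\<close> isolates
    \<open>N s\<close> on the left; on the right the product with \<open>e * q ^ k\<close> is the
    power of \<open>cmod q\<close>.\<close>
  also have "\<dots> = e * cnj q ^ k * (cnj (e * inverse q ^ k) * N s)"
    using e2 by simp
  also have "\<dots> = (e * e) * (cnj q ^ k * q ^ k) * qnum q (int (Suc (r i)))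
      * qnum q (int p - int (rsum n m r)) * N r"
    unfolding eq by (simp only: mult_ac)
  finally show ?thesis
    unfolding s_def[symmetric] k_def[symmetric] using e2 qq by simp
qed

text \<open>The bound on \<open>rsum\<close> makes the class nonzero. Positive definiteness speaks
  only of the real part; Hermitian symmetry removes the imaginary part.\<close>

lemma norm_ket_pos:
  assumes form: "fock_form n m p q B" and pd: "positive_definite n m p B"
    and r: "r \<in> occ n m" "rsum n m r \<le> p"
  shows "\<exists>x>0. B (cls n m p (ket r)) (cls n m p (ket r)) = complex_of_real x"
proof -
  let ?X = "cls n m p (ket r)"
  have X: "?X \<in> Fock n m p" using r by (simp add: ket_in_Wbar cls_in_Fock)
  have "?X \<noteq> cls n m p 0"
    using r cls_eq_iff[of "ket r" n m 0 p]
    by (auto simp: ket_in_Wbar Wbar_def Vsub_def ket_def)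
  then have "0 < Re (B ?X ?X)" using pd X by (simp add: positive_definite_def)
  moreover have "B ?X ?X = cnj (B ?X ?X)"
    using form X unfolding fock_form_def hermitian_form_def by blast
  then have "Im (B ?X ?X) = 0" by (simp add: complex_eq_iff)
  ultimately show ?thesis by (intro exI[of _ "Re (B ?X ?X)"]) (simp add: complex_eq_iff)
qed

text \<open>Adding to mode 2 after mode 1 passes one particle and yields \<open>cmod q ^ 2\<close>;
  adding to mode 1 after mode 2 passes none. All other factors agree, and the common norm is nonzero
  because \<open>2 \<le> p\<close>.\<close>

lemma unitary_cmod:
  assumes form: "fock_form n m p q B" and pd: "positive_definite n m p B"
    and "q \<noteq> 0" "2 \<le> p" "2 \<le> n + m"
  shows "cmod q = 1"
proof -
  define N where "N r = B (cls n m p (ket r)) (cls n m p (ket r))" for r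
  let ?z = "(\<lambda>_. 0) :: nat \<Rightarrow> nat"
  define e1 where "e1 = ?z(1 := Suc 0)"
  define e2 where "e2 = ?z(2 := Suc 0)"
  define e12 where "e12 = ?z(1 := Suc 0, 2 := Suc 0)"
  have ij: "1 \<in> {1..n+m}" "2 \<in> {1..n+m}" using assms(5) by auto
  have z: "?z \<in> occ n m" "rsum n m ?z = 0" by (simp_all add: occ_def rsum_def)
  have e: "e1 \<in> occ n m" "e2 \<in> occ n m" "e12 \<in> occ n m"
    using ij by (auto simp: occ_def e1_def e2_def e12_def)
  have s1: "rsum n m e1 = 1" "rsum n m e2 = 1"
    using rsum_Suc[OF ij(1), of ?z] rsum_Suc[OF ij(2), of ?z] z by (simp_all add: e1_def e2_def)
  have s12: "rsum n m e12 = 2"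
    using rsum_Suc[OF ij(2), of e1] s1 by (simp add: e1_def e12_def)
  have one: "qnum q (int (Suc 0)) = 1" using qnum_1[OF assms(3)] by simp
  have iv: "{1..<2::nat} = {1}" by auto
  note step = norm_step[OF form assms(3), folded N_def]
  have N1: "N e1 = qnum q (int p) * N ?z"
    using step[OF ij(1) z(1)] z one by (simp add: e1_def)
  have N2: "N e2 = qnum q (int p) * N ?z"
    using step[OF ij(2) z(1)] z one by (simp add: e2_def)
  have path1: "N e12 = of_real (cmod q ^ 2) * qnum q (int p - 1) * N e1"
    using step[OF ij(2) e(1)] s1 one iv by (simp add: e1_def e12_def)
  have path2: "N e12 = qnum q (int p - 1) * N e2"
  proof -
    have "e2(1 := Suc (e2 1)) = e12" by (auto simp: e2_def e12_def)
    then show ?thesis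
      using step[OF ij(1) e(2)] s1 one by (simp add: e2_def)
  qed
  have "N e12 \<noteq> 0"
    using norm_ket_pos[OF form pd e(3)] s12 assms(4) by (auto simp: N_def)
  moreover have "N e12 = of_real (cmod q ^ 2) * N e12"
    by (metis N1 N2 mult.assoc path1 path2)
  ultimately have "of_real (cmod q ^ 2) = (1::complex)" by simp
  then have "cmod q ^ 2 = 1" using of_real_eq_1_iff by blast
  then show ?thesis using norm_ge_zero[of q] by (simp add: power2_eq_1_iff)
qed

text \<open>Adding a particle to an empty mode of a state with \<open>p - x\<close> particles
  multiplies the norm by \<open>[1] [x] = [x]\<close>, so \<open>[x]\<close> is a quotient of two
  positive norms.\<close>

lemma unitary_qnum_pos:
  assumes form: "fock_form n m p q B" and pd: "positive_definite n m p B"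
    and "q \<noteq> 0" "2 \<le> n + m" "cmod q = 1"
    and x: "1 \<le> x" "x \<le> p" "n = 0 \<Longrightarrow> p < x + m"
  shows "0 < Re (qnum q (int x))"
proof -
  obtain r i where i: "i \<in> {1..n+m}" "r i = 0" and r: "r \<in> occ n m" "rsum n m r = p - x"
  proof (cases "n = 0")
    case True
    \<comment> \<open>With \<open>n = 0\<close> every mode holds at most one particle: the first
      \<open>p - x\<close> modes are filled, and the bound on \<open>x\<close> leaves the next one
      empty.\<close>
    let ?r = "\<lambda>j. if j \<in> {1..p-x} then 1 else 0 :: nat"
    have le: "p - x < m" using True x by linarith
    have "rsum n m ?r = (\<Sum>j\<in>{1..p-x}. 1)"
      unfolding rsum_def using True le by (intro sum.mono_neutral_cong_right) auto
    moreover have "?r \<in> occ n m" using True le by (auto simp: occ_def)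
    ultimately show ?thesis
      using that[of "p - x + 1" ?r] True le by simp
  next
    case False
    \<comment> \<open>Mode 1 is even and can hold all \<open>p - x\<close> particles, so mode 2
      stays empty.\<close>
    let ?r = "(\<lambda>_. 0)(1 := p - x)"
    have "?r \<in> occ n m" using False by (auto simp: occ_def)
    moreover have "rsum n m ?r = p - x"
      using rsum_upd[of 1 n m "\<lambda>_. 0" "p - x"] False by (simp add: rsum_def)
    ultimately show ?thesis using that[of 2 ?r] assms(4) by simp
  qed
  let ?s = "r(i := Suc (r i))"
  have s: "?s \<in> occ n m" "rsum n m ?s \<le> p"
    using occ_Suc[OF r(1) i(1)] i(2) rsum_Suc[OF i(1), of r] r(2) x by simp_all
  have "int p - int (rsum n m r) = int x" using r(2) x by simp
  then have "B (cls n m p (ket ?s)) (cls n m p (ket ?s)) =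
      qnum q (int x) * B (cls n m p (ket r)) (cls n m p (ket r))"
    using norm_step[OF form assms(3) i(1) r(1)] i(2) assms(5) qnum_1[OF assms(3)] by simp
  moreover obtain a b where "0 < a" "0 < b"
    "B (cls n m p (ket ?s)) (cls n m p (ket ?s)) = complex_of_real a"
    "B (cls n m p (ket r)) (cls n m p (ket r)) = complex_of_real b"
    using norm_ket_pos[OF form pd s] norm_ket_pos[OF form pd r(1)] r(2) by force
  ultimately have "qnum q (int x) = complex_of_real (a / b)" and "0 < a / b"
    by (simp_all add: field_simps)
  then show ?thesis by simp
qed

text \<open>For \<open>n > 0\<close> all \<open>[x]\<close> with \<open>1 \<le> x \<le> p\<close>
  are positive. For \<open>n = 0\<close> this is known only for \<open>x\<close> from
  \<open>p - (m - 1)\<close> on, and \<open>bound\<close> is the condition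
  \<open>a \<le> 2 * (p - a)\<close> of \<open>sin_pos_consecutive\<close> at that
  \<open>a\<close>.\<close>

lemma unitary_imp_phase:
  assumes "fock_unitary n m p q" "q \<noteq> 0" "2 \<le> p" "2 \<le> n + m"
    and bound: "n = 0 \<Longrightarrow> p \<le> 3 * (m - 1)"
  shows "\<exists>\<phi>::real. \<bar>\<phi>\<bar> < pi / real p \<and> q = cis \<phi>"
proof -
  obtain B where B: "fock_form n m p q B" "positive_definite n m p B"
    using assms(1) by (auto simp: fock_unitary_def)
  have cq: "cmod q = 1" using unitary_cmod[OF B assms(2-4)] .
  note pos = unitary_qnum_pos[OF B assms(2,4) cq]
  define \<phi> where "\<phi> = Arg q"
  have q: "q = cis \<phi>" using assms(2) cq cis_Arg[of q] by (simp add: \<phi>_def sgn_eq)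
  have \<phi>: "- pi < \<phi>" "\<phi> \<le> pi" using Arg_bounded[of q] by (simp_all add: \<phi>_def)
  \<comment> \<open>The principal argument may equal \<open>pi\<close>, where
    \<open>sin \<phi> = 0\<close>. At \<open>q = -1\<close> the values \<open>[p]\<close> and
    \<open>[p - 1]\<close> have opposite signs, although both must be positive.\<close>
  have "\<phi> \<noteq> pi"
  proof
    assume "\<phi> = pi"
    then have "q = -1" using q by simp
    then have "qnum q x = (-1) powi (x - 1) * of_int x" for x by (simp add: qnum_def)
    moreover have "0 < Re (qnum q (int p))" "0 < Re (qnum q (int (p - 1)))"
      using pos[of p] pos[of "p - 1"] assms(3,4) by auto
    moreover have "int p - 1 = int (p - 1)" "int (p - 1) - 1 = int (p - 2)" "p - 1 = Suc (p - 2)"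
      using assms(3) by auto
    ultimately have "0 < Re ((-1) ^ (p - 1) * of_nat p)" "0 < Re ((-1) ^ (p - 2) * of_nat (p - 1))"
      by (metis of_int_of_nat_eq power_int_of_nat)+
    then show False
      using \<open>p - 1 = Suc (p - 2)\<close> by (cases "even (p - 2)") auto
  qed
  have "real p * \<bar>\<phi>\<bar> < pi"
  proof (cases "\<phi> = 0")
    case False
    \<comment> \<open>The least \<open>x\<close> for which \<open>p - x\<close> particles leave an
      empty mode. Truncated subtraction may give 0, hence \<open>max 1 a\<close> below.\<close>
    define a where "a = (if n = 0 then p - (m - 1) else 1)"
    have absl: "0 < \<bar>\<phi>\<bar>" "\<bar>\<phi>\<bar> < pi" using \<phi> \<open>\<phi> \<noteq> pi\<close> False by auto
    then have sp: "0 < sin \<bar>\<phi>\<bar>" by (intro sin_gt_zero)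
    then have s0: "sin \<phi> \<noteq> 0" by (auto simp: abs_if split: if_splits)
    have sin_pos: "0 < sin (real x * \<bar>\<phi>\<bar>)" if "1 \<le> x" "x \<le> p" "n = 0 \<Longrightarrow> p < x + m" for x
    proof -
      have "0 < sin (real x * \<phi>) / sin \<phi>"
        using pos[OF that] qnum_cis[OF s0, of "int x"] q by simp
      then show ?thesis using sp by (auto simp: abs_if zero_less_divide_iff split: if_splits)
    qed
    show ?thesis
    proof (rule sin_pos_consecutive[OF absl, of "max 1 a"])
      show "max 1 a \<le> p" using assms(3) by (auto simp: a_def)
      show "0 < sin (real x * \<bar>\<phi>\<bar>)" if "max 1 a \<le> x" "x \<le> p" for x
        using sin_pos[of x] that assms(4) by (auto simp: a_def split: if_splits)
      show "max 1 a = 1 \<or> max 1 a \<le> 2 * (p - max 1 a)"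
        using bound assms(4) by (auto simp: a_def max_def)
    qed
  qed simp
  then show ?thesis
    using q assms(3) by (intro exI[of _ \<phi>]) (simp add: field_simps)
qed

section \<open>The form at a phase\<close>

definition low :: "nat \<Rightarrow> nat \<Rightarrow> nat \<Rightarrow> (nat \<Rightarrow> nat) set" where
  "low n m p = {r \<in> occ n m. rsum n m r \<le> p}"

text \<open>With \<open>g x = [x]\<close> this is the product of the q-factorials
  \<open>[r_i]!\<close> and the falling q-factorial \<open>[p] [p - 1] ... [p - N + 1]\<close>,
  where \<open>N\<close> is the particle number: the squared norm that \<open>norm_step\<close>
  prescribes at \<open>cmod q = 1\<close>.\<close>

definition weight :: "nat \<Rightarrow> nat \<Rightarrow> nat \<Rightarrow> (nat \<Rightarrow> real) \<Rightarrow> (nat \<Rightarrow> nat) \<Rightarrow> real" where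
  "weight n m p g r = (\<Prod>i=1..n+m. \<Prod>k=1..r i. g k) * (\<Prod>j<rsum n m r. g (p - j))"

definition wform ::
  "nat \<Rightarrow> nat \<Rightarrow> nat \<Rightarrow> (nat \<Rightarrow> real) \<Rightarrow> state \<Rightarrow> state \<Rightarrow> complex" where
  "wform n m p g v w = (\<Sum>r\<in>low n m p.
     cnj (Poly_Mapping.lookup v r) * Poly_Mapping.lookup w r * of_real (weight n m p g r))"

text \<open>Representatives are picked by choice; \<open>qform_cls\<close> shows that the value does
  not depend on them.\<close>

definition qform ::
  "nat \<Rightarrow> nat \<Rightarrow> nat \<Rightarrow> (nat \<Rightarrow> real) \<Rightarrow> state set \<Rightarrow> state set \<Rightarrow> complex" where
  "qform n m p g X Y = wform n m p g (SOME v. v \<in> X) (SOME w. w \<in> Y)"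

section \<open>Recursion and positivity of the weights\<close>

lemma rsum_ge: "i \<in> {1..n+m} \<Longrightarrow> r i \<le> rsum n m r"
  unfolding rsum_def by (rule member_le_sum) auto

lemma finite_low: "finite (low n m p)"
proof (rule finite_subset)
  show "low n m p \<subseteq> {r. \<forall>i. (i \<in> {1..n+m} \<longrightarrow> r i \<in> {..p}) \<and> (i \<notin> {1..n+m} \<longrightarrow> r i = 0)}"
  proof
    fix r assume r: "r \<in> low n m p"
    have "r i \<le> p" if "i \<in> {1..n+m}" for i
      using rsum_ge[OF that, of r] r by (simp add: low_def)
    then show "r \<in> {r. \<forall>i. (i \<in> {1..n+m} \<longrightarrow> r i \<in> {..p}) \<and> (i \<notin> {1..n+m} \<longrightarrow> r i = 0)}"
      using r by (simp add: low_def occ_def)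
  qed
  show "finite {r. \<forall>i. (i \<in> {1..n+m} \<longrightarrow> r i \<in> {..p}) \<and> (i \<notin> {1..n+m} \<longrightarrow> r i = (0::nat))}"
    by (rule finite_set_of_finite_funs) auto
qed

text \<open>The same recursion as \<open>norm_step\<close> without the power of
  \<open>cmod q\<close>: one new factor ends the factorial of mode \<open>i\<close>, the other ends
  the falling factorial.\<close>

lemma weight_Suc:
  assumes i: "i \<in> {1..n+m}"
  shows "weight n m p g (r(i := Suc (r i))) = g (Suc (r i)) * g (p - rsum n m r) * weight n m p g r"
proof -
  let ?f = "\<lambda>r i. \<Prod>k=1..r i. g k"
  have "(\<Prod>j=1..n+m. ?f (r(i := Suc (r i))) j)
      = ?f (r(i := Suc (r i))) i * (\<Prod>j\<in>{1..n+m}-{i}. ?f (r(i := Suc (r i))) j)"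
    using i by (subst prod.remove[of _ i]) auto
  also have "(\<Prod>j\<in>{1..n+m}-{i}. ?f (r(i := Suc (r i))) j) = (\<Prod>j\<in>{1..n+m}-{i}. ?f r j)"
    by (rule prod.cong) auto
  also have "?f (r(i := Suc (r i))) i * (\<Prod>j\<in>{1..n+m}-{i}. ?f r j)
      = g (Suc (r i)) * (?f r i * (\<Prod>j\<in>{1..n+m}-{i}. ?f r j))"
    by simp
  also have "?f r i * (\<Prod>j\<in>{1..n+m}-{i}. ?f r j) = (\<Prod>j=1..n+m. ?f r j)"
    using i by (subst prod.remove[of "{1..n+m}" i]) auto
  finally show ?thesis
    using rsum_Suc[OF i, of r] by (simp add: weight_def)
qed

lemma weight_pos:
  assumes g: "\<And>x. 1 \<le> x \<Longrightarrow> x \<le> p \<Longrightarrow> 0 < g x" and r: "r \<in> low n m p"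
  shows "0 < weight n m p g r"
proof -
  have "0 < g k" if "i \<in> {1..n+m}" "k \<in> {1..r i}" for i k
    using that rsum_ge[of i n m r] r by (intro g) (auto simp: low_def)
  moreover have "0 < g (p - j)" if "j < rsum n m r" for j
    using that r by (intro g) (auto simp: low_def)
  ultimately show ?thesis
    unfolding weight_def by (intro mult_pos_pos prod_pos) auto
qed

lemma low_upd_iff:
  assumes "i \<in> {1..n+m}"
  shows "r(i := Suc (r i)) \<in> low n m p \<longleftrightarrow>
    r \<in> low n m p \<and> rsum n m r < p \<and> par n i * r i = 0"
proof
  assume s: "r(i := Suc (r i)) \<in> low n m p"
  have "r(i := Suc (r i), i := Suc (r i) - 1) \<in> occ n m"
    using occ_pred[of "r(i := Suc (r i))" n m i] s by (simp add: low_def)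
  then have "r \<in> occ n m" by simp
  moreover have "par n i * r i = 0"
  proof (cases "i \<le> n")
    case False
    then have "i \<in> {n+1..n+m}" using assms by simp
    then have "(r(i := Suc (r i))) i \<le> 1"
      using s unfolding low_def occ_def by blast
    then show ?thesis by simp
  qed (simp add: par_def)
  ultimately show "r \<in> low n m p \<and> rsum n m r < p \<and> par n i * r i = 0"
    using s rsum_Suc[OF assms, of r] by (simp add: low_def)
next
  assume "r \<in> low n m p \<and> rsum n m r < p \<and> par n i * r i = 0"
  then show "r(i := Suc (r i)) \<in> low n m p"
    using occ_Suc[OF _ assms, of r] rsum_Suc[OF assms, of r] by (auto simp: low_def)
qed

section \<open>Adjointness on representatives\<close>

lemma wform_sym: "wform n m p g w v = cnj (wform n m p g v w)"
  by (simp add: wform_def mult_ac)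

lemma wform_Hop: "wform n m p g (Hop n m p i v) w = wform n m p g v (Hop n m p i w)"
  unfolding wform_def by (rule sum.cong) (simp_all add: lookup_Hop)

text \<open>Both sides are sums over pairs of a label \<open>r\<close> and its raised label, both in
  \<open>low\<close>; \<open>weight_Suc\<close> matches them term by term.\<close>

lemma wform_adjoint:
  assumes i: "i \<in> {1..n+m}" and w: "w \<in> Wbar n m" and cq: "cmod q = 1"
    and g: "\<And>x. qnum q (int x) = of_real (g x)"
  shows "wform n m p g (aplus n q i v) w = wform n m p g v (amin n m p q i w)"
proof -
  let ?up = "\<lambda>r. r(i := Suc (r i))"
  let ?S = "{s \<in> low n m p. s i \<noteq> 0}"
  let ?R = "{r \<in> low n m p. ?up r \<in> low n m p}"
  let ?lhs = "\<lambda>s. cnj (Poly_Mapping.lookup (aplus n q i v) s) * Poly_Mapping.lookup w s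
    * of_real (weight n m p g s)"
  let ?rhs = "\<lambda>r. cnj (Poly_Mapping.lookup v r) * Poly_Mapping.lookup (amin n m p q i w) r
    * of_real (weight n m p g r)"
  \<comment> \<open>This is where \<open>cmod q = 1\<close> enters: conjugation turns the
    \<open>q\<close>-power of the raising operator into that of the lowering operator.\<close>
  have cnj_inv: "cnj (inverse q) = q"
    using cq by (metis complex_cnj_inverse complex_norm_square inverse_unique
        mult.commute of_real_1 one_power2)
  have "wform n m p g (aplus n q i v) w = (\<Sum>s\<in>?S. ?lhs s)"
    unfolding wform_def using finite_low
    by (intro sum.mono_neutral_right) (auto simp: lookup_aplus)
  also have "\<dots> = (\<Sum>r\<in>?R. ?lhs (?up r))"
  proof (rule sum.reindex_bij_witness[of _ ?up "\<lambda>s. s(i := s i - 1)"])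
    fix s assume "s \<in> ?S"
    then have s: "s \<in> low n m p" "s i \<noteq> 0" by auto
    show u: "?up (s(i := s i - 1)) = s" using s by simp
    have "?up (s(i := s i - 1)) \<in> low n m p" unfolding u by (rule s)
    then show "s(i := s i - 1) \<in> ?R"
      using low_upd_iff[OF i, of "s(i := s i - 1)" p] by blast
    show "?lhs (?up (s(i := s i - 1))) = ?lhs s" unfolding u ..
  qed auto
  also have "\<dots> = (\<Sum>r\<in>?R. ?rhs r)"
  proof (rule sum.cong)
    fix r assume "r \<in> ?R"
    then have r: "par n i * r i = 0" "rsum n m r < p"
      using low_upd_iff[OF i, of r p] by auto
    have d: "int p - int (rsum n m r) = int (p - rsum n m r)" using r by simp
    let ?sg = "(-1) ^ (\<Sum>j=1..<i. par n j * r j) :: complex"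
    let ?k = "\<Sum>j=1..<i. r j"
    have up: "Poly_Mapping.lookup (aplus n q i v) (?up r) =
        Poly_Mapping.lookup v r * (?sg * inverse q ^ ?k)"
      unfolding lookup_aplus raise_coeff_def using r(1) by (simp only: fun_upd_same
          fun_upd_upd fun_upd_triv diff_Suc_1 nat.simps if_False of_nat_0 diff_zero mult_1_right)
    have down: "Poly_Mapping.lookup (amin n m p q i w) r =
        Poly_Mapping.lookup w (?up r) * (?sg * q ^ ?k
          * of_real (g (Suc (r i))) * of_real (g (p - rsum n m r)))"
      unfolding lookup_amin Suc_eq_plus1[symmetric] lower_coeff_Suc[OF i] d g ..
    show "?lhs (?up r) = ?rhs r"
      unfolding up down weight_Suc[OF i]
      by (simp only: of_real_mult complex_cnj_mult complex_cnj_power complex_cnj_minus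
          complex_cnj_one cnj_inv mult_ac)
  qed auto
  also have "\<dots> = wform n m p g v (amin n m p q i w)"
    unfolding wform_def
  \<comment> \<open>The remaining labels have either \<open>rsum n m r = p\<close>, where the
    lowering coefficient contains \<open>[0]\<close>, or an occupied odd mode \<open>i\<close>,
    where \<open>w \<in> Wbar n m\<close> vanishes at the raised label.\<close>
  proof (rule sum.mono_neutral_left)
    show "\<forall>r\<in>low n m p - ?R. ?rhs r = 0"
    proof
      fix r assume "r \<in> low n m p - ?R"
      then consider "rsum n m r = p" | "?up r \<notin> occ n m"
        using rsum_Suc[OF i, of r] by (fastforce simp: low_def)
      then have "Poly_Mapping.lookup (amin n m p q i w) r = 0"
      proof cases
        case 1
        then show ?thesis by (simp add: lookup_amin lower_coeff_Suc[OF i] qnum_0)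
      next
        case 2
        then have "Poly_Mapping.lookup w (?up r) = 0"
          using w by (auto simp: Wbar_def in_keys_iff subset_iff)
        then show ?thesis by (simp add: lookup_amin)
      qed
      then show "?rhs r = 0" by simp
    qed
  qed (auto intro: finite_low)
  finally show ?thesis .
qed

section \<open>Passage to the quotient and positivity\<close>

text \<open>Two representatives of a class differ by an element of \<open>Vsub\<close>, which has no
  support in \<open>low\<close>, the only place where \<open>wform\<close> evaluates its
  arguments.\<close>

lemma qform_cls:
  assumes "v \<in> Wbar n m" "w \<in> Wbar n m"
  shows "qform n m p g (cls n m p v) (cls n m p w) = wform n m p g v w"
proof -
  have rep: "Poly_Mapping.lookup (SOME u. u \<in> cls n m p x) r = Poly_Mapping.lookup x r"
    if x: "x \<in> Wbar n m" and r: "r \<in> low n m p" for x r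
  proof -
    have "x \<in> cls n m p x"
      unfolding cls_def by (rule equiv_class_self[OF equiv_fock_rel x])
    then have "(SOME u. u \<in> cls n m p x) \<in> cls n m p x" by (rule someI)
    then have "r \<notin> Poly_Mapping.keys (x - (SOME u. u \<in> cls n m p x))"
      using r by (auto simp: cls_def fock_rel_def Vsub_def low_def)
    then show ?thesis by (simp add: in_keys_iff lookup_minus)
  qed
  show ?thesis
    unfolding qform_def wform_def by (rule sum.cong) (simp_all add: rep assms)
qed

lemma Fock_cases:
  assumes "X \<in> Fock n m p"
  obtains v where "v \<in> Wbar n m" "X = cls n m p v"
  using assms unfolding Fock_def cls_def by (rule quotientE) blast

lemma adjoint_qformI:
  assumes S: "\<And>v. v \<in> Wbar n m \<Longrightarrow> S v \<in> Wbar n m"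
      "\<And>v. v \<in> Wbar n m \<Longrightarrow> qlift n m p S (cls n m p v) = cls n m p (S v)"
    and T: "\<And>v. v \<in> Wbar n m \<Longrightarrow> T v \<in> Wbar n m"
      "\<And>v. v \<in> Wbar n m \<Longrightarrow> qlift n m p T (cls n m p v) = cls n m p (T v)"
    and "\<And>v w. v \<in> Wbar n m \<Longrightarrow> w \<in> Wbar n m \<Longrightarrow> wform n m p g (S v) w = wform n m p g v (T w)"
  shows "adjoint_wrt n m p (qform n m p g) S T"
  unfolding adjoint_wrt_def
proof (intro ballI)
  fix X Y assume "X \<in> Fock n m p" "Y \<in> Fock n m p"
  then obtain v w where "v \<in> Wbar n m" "w \<in> Wbar n m" "X = cls n m p v" "Y = cls n m p w"
    by (metis Fock_cases)
  then show "qform n m p g (qlift n m p S X) Y = qform n m p g X (qlift n m p T Y)"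
    using assms by (simp add: qform_cls)
qed

lemma add_in_Wbar: "v \<in> Wbar n m \<Longrightarrow> w \<in> Wbar n m \<Longrightarrow> v + w \<in> Wbar n m"
  using Poly_Mapping.keys_add[of v w] unfolding Wbar_def by blast

lemma hermitian_qform: "hermitian_form n m p (qform n m p g)"
  unfolding hermitian_form_def
proof (intro conjI ballI allI)
  fix X Y Z assume "X \<in> Fock n m p" "Y \<in> Fock n m p" "Z \<in> Fock n m p"
  then obtain u v w where "u \<in> Wbar n m" "v \<in> Wbar n m" "w \<in> Wbar n m"
    "X = cls n m p u" "Y = cls n m p v" "Z = cls n m p w"
    by (metis Fock_cases)
  then show "qform n m p g X (fadd n m p Y Z) = qform n m p g X Y + qform n m p g X Z"
    by (simp add: cls_add qform_cls add_in_Wbar wform_def lookup_add algebra_simps sum.distrib)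
next
  fix X Y c assume "X \<in> Fock n m p" "Y \<in> Fock n m p"
  then obtain u v where "u \<in> Wbar n m" "v \<in> Wbar n m" "X = cls n m p u" "Y = cls n m p v"
    by (metis Fock_cases)
  then show "qform n m p g X (qlift n m p (scal c) Y) = c * qform n m p g X Y"
    by (simp add: cls_scal qform_cls scal_in_Wbar wform_def lookup_scal sum_distrib_left mult_ac)
next
  fix X Y assume "X \<in> Fock n m p" "Y \<in> Fock n m p"
  then show "qform n m p g Y X = cnj (qform n m p g X Y)"
    unfolding qform_def using wform_sym by blast
qed

text \<open>The value is the weighted sum of \<open>\<bar>v_r\<bar>^2\<close> over
  \<open>low\<close>, and a vector outside \<open>Vsub\<close> has a nonzero coefficient
  there.\<close>

lemma wform_pos:
  assumes g: "\<And>x. 1 \<le> x \<Longrightarrow> x \<le> p \<Longrightarrow> 0 < g x"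
    and v: "v \<in> Wbar n m" "v \<notin> Vsub n m p"
  shows "0 < Re (wform n m p g v v)"
proof -
  let ?t = "\<lambda>r. (cmod (Poly_Mapping.lookup v r))\<^sup>2 * weight n m p g r"
  have "wform n m p g v v = complex_of_real (\<Sum>r\<in>low n m p. ?t r)"
    unfolding wform_def of_real_sum
    by (rule sum.cong) (simp_all only: of_real_mult complex_norm_square mult.commute)
  moreover obtain r where "r \<in> low n m p" "Poly_Mapping.lookup v r \<noteq> 0"
    using v by (auto simp: Vsub_def Wbar_def low_def subset_iff in_keys_iff not_less)
  then have "0 < (\<Sum>r\<in>low n m p. ?t r)"
    using weight_pos[of p g _ n m] g finite_low
    by (intro sum_pos2[of _ r]) (auto simp: less_imp_le)
  ultimately show ?thesis by simp
qed

lemma phase_imp_unitary: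
  assumes "2 \<le> p" "\<bar>\<phi>\<bar> < pi / real p"
  shows "fock_unitary n m p (cis \<phi>)"
proof -
  define q where "q = cis \<phi>"
  define g where "g x = Re (qnum q (int x))" for x :: nat
  let ?B = "qform n m p g"
  have g_pos: "0 < g x" if "1 \<le> x" "x \<le> p" for x
    using qnum_phase_pos(1)[OF assms that] by (simp add: g_def q_def)
  have g_eq: "qnum q (int x) = of_real (g x)" for x
    using qnum_phase_pos(2)[OF assms, of 1] assms(1) by (simp add: g_def q_def)
  have cq: "cmod q = 1" by (simp add: q_def)
  have vac: "?B (cls n m p (ket (\<lambda>_. 0))) (cls n m p (ket (\<lambda>_. 0))) = 1"
  proof -
    have z: "(\<lambda>_. 0) \<in> low n m p" by (simp add: low_def occ_def rsum_def)
    have "wform n m p g (ket (\<lambda>_. 0)) (ket (\<lambda>_. 0)) =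
        (\<Sum>r\<in>low n m p. if r = (\<lambda>_. 0) then of_real (weight n m p g (\<lambda>_. 0)) else 0)"
      unfolding wform_def by (rule sum.cong) (auto simp: ket_def lookup_single when_def)
    also have "\<dots> = 1"
      using z finite_low by (simp add: weight_def rsum_def)
    finally show ?thesis
      using z by (simp add: qform_cls ket_in_Wbar low_def)
  qed
  have adj: "adjoint_wrt n m p ?B (aplus n q i) (amin n m p q i)"
    "adjoint_wrt n m p ?B (amin n m p q i) (aplus n q i)" if i: "i \<in> {1..n+m}" for i
  proof -
    note adj = wform_adjoint[OF i _ cq g_eq]
    show "adjoint_wrt n m p ?B (aplus n q i) (amin n m p q i)"
      by (rule adjoint_qformI)
         (simp_all only: aplus_inv(1)[OF i] amin_inv(1)[OF i] lift_aplus lift_amin i adj)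
    \<comment> \<open>The second adjointness is the complex conjugate of the first with
      \<open>v\<close> and \<open>w\<close> exchanged.\<close>
    have "wform n m p g (amin n m p q i v) w = wform n m p g v (aplus n q i w)"
      if "v \<in> Wbar n m" for v w
      by (subst (1 2) wform_sym) (simp only: adj[OF that])
    then show "adjoint_wrt n m p ?B (amin n m p q i) (aplus n q i)"
      by (intro adjoint_qformI)
         (simp_all only: aplus_inv(1)[OF i] amin_inv(1)[OF i] lift_aplus lift_amin i)
  qed
  have adjH: "adjoint_wrt n m p ?B (Hop n m p i) (Hop n m p i)" for i
    by (rule adjoint_qformI) (simp_all only: Hop_inv(1) lift_Hop wform_Hop)
  have "positive_definite n m p ?B"
    unfolding positive_definite_def
  proof (intro ballI impI)
    fix X assume "X \<in> Fock n m p" "X \<noteq> cls n m p 0"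
    then obtain v where v: "v \<in> Wbar n m" "X = cls n m p v" by (metis Fock_cases)
    have "v \<notin> Vsub n m p"
      using \<open>X \<noteq> cls n m p 0\<close> v cls_eq_iff[of v n m 0 p] by (auto simp: Wbar_def)
    then show "0 < Re (?B X X)"
      using wform_pos[of p g v n m] g_pos v by (simp add: qform_cls)
  qed
  then have "fock_unitary n m p q"
    unfolding fock_unitary_def fock_form_def using hermitian_qform vac adj adjH by blast
  then show ?thesis by (simp add: q_def)
qed

text \<open>The hypothesis \<open>2 \<le> n + m\<close> supplies the two modes whose orders of
  filling are compared in \<open>unitary_cmod\<close>; the last one treats the case in which all
  modes are odd.\<close>

theorem theorem6:
  fixes n m p :: nat and q :: complex
  assumes "q \<noteq> 0"
    and "2 \<le> p"
    and "2 \<le> n + m"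
    and "n = 0 \<Longrightarrow> p \<le> 3 * (m - 1)"
  shows "fock_unitary n m p q \<longleftrightarrow>
    (\<exists>\<phi>::real. - (pi / real p) < \<phi> \<and> \<phi> < pi / real p \<and>
       q = exp (\<i> * complex_of_real \<phi>))"
proof -
  have "fock_unitary n m p q \<longleftrightarrow> (\<exists>\<phi>::real. \<bar>\<phi>\<bar> < pi / real p \<and> q = cis \<phi>)"
    using unitary_imp_phase[OF _ assms] phase_imp_unitary[OF assms(2)] by blast
  also have "\<dots> \<longleftrightarrow> (\<exists>\<phi>::real. - (pi / real p) < \<phi> \<and> \<phi> < pi / real p \<and>
      q = exp (\<i> * complex_of_real \<phi>))"
    by (rule arg_cong[where f = Ex]) (auto simp: abs_less_iff cis_conv_exp)
  finally show ?thesis .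
qed

end
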